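(* Let $G$ be a finite graph cellularly embedded in a compact, connected, orientable, boundaryless surface $\Sigma$, with dual graph $G^*$ and positive constants $(J_{e^*})_{e^*\in E^*}$. The dimer model partition function $Z^0_{\mathrm{quadri}}(G^Q,J)$ can be rewritten as $$Z^0_{\mathrm{quadri}}(G^Q,J)=2\sum_{\substack{(P,P^* )\in\mathcal P^0(G)\times\mathcal P^0(G^* )\\ P\cap P^*=\emptyset}}\Bigl(\prod_{e\in P}\frac{2e^{-2J_{e^*}}}{1+e^{-4J_{e^*}}}\Bigr)\Bigl(\prod_{e^*\in P^*}\frac{1-e^{-4J_{e^*}}}{1+e^{-4J_{e^*}}}\Bigr),$$ where the pairs of primal and dual polygon configurations of $\mathcal P^0(G)\times\mathcal P^0(G^* )$ are the $\mathrm{Poly}$ configurations, i.e. the term indexed by $(P,P^* )$ (including the factor $2$) is the total weight of the dimer configurations $M$ of $G^Q$ with $\mathrm{Poly}(M)=(P,P^* )$.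
   Context: $G=(V,E)$, $G^*=(V^*,E^* )$, $e\mapsto e^*$ the bijection between edges and dual edges. A polygon configuration of $G$ (resp. $G^*$) is a subset of edges such that every vertex is incident to an even number of them; $\mathcal P^0(G)$ (resp. $\mathcal P^0(G^* )$) is the set of those with zero class in $H_1(\Sigma;\mathbb Z/2\mathbb Z)$. $P\cap P^*=\emptyset$ means there is no $e\in P$ with $e^*\in P^*$. Medial graph $G^M$: it has one (4-valent) vertex $v(e)$ per edge $e$ of $G$, and two medial vertices are joined by an edge through each corner of a face at which the corresponding edges of $G$ are consecutive. The four medial edges at $v(e)$ lie in the four sectors delimited by $e$ and $e^*$. Quadri-tiling graph $G^Q$: it is obtained from $G^M$ by replacing each vertex $v(e)$ by a quadrangle (a 4-cycle) whose four corners are attached, in cyclic order, to the four medial edges at $v(e)$. It is a bipartite graph embedded in $\Sigma$. Edges coming from $G^M$ are external, the edges of quadrangles are internal (interior). In the quadrangle of $v(e)$, two internal edges are parallel to $e$ (each joins two corners on the same side of $e$) and two are parallel to $e^*$ (each joins two corners on the same side of $e^*$). Dimer configurations: a dimer configuration (perfect matching) $M$ of $G^Q$ is a set of edges covering every vertex exactly once. Its weight is the product of its edge weights: external edges have weight $1$, internal edges parallel to $e\in E$ have weight $a_e=\frac{2e^{-2J_{e^*}}}{1+e^{-4J_{e^*}}}$, and internal edges parallel to $e^*\in E^*$ have weight $b_{e^*}=\frac{1-e^{-4J_{e^*}}}{1+e^{-4J_{e^*}}}$. Map $\mathrm{Poly}$: given $M$, the external edges in $M$ form an edge configuration of $G^M$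 such that around each vertex of $G^M$ either none, all, or exactly two consecutive edges are present (a 6-vertex configuration). For each $e$: if exactly two medial edges at $v(e)$ are present, select whichever of $e$, $e^*$ separates the two present from the two absent medial edges at $v(e)$; otherwise select nothing. $\mathrm{Poly}_1(M)\subset E$ and $\mathrm{Poly}_2(M)\subset E^*$ are the sets of selected primal and dual edges (they are polygon configurations), and $\mathrm{Poly}(M)=(\mathrm{Poly}_1(M),\mathrm{Poly}_2(M))$. $\mathcal M^0(G^Q)$ is the set of dimer configurations $M$ of $G^Q$ such that $\mathrm{Poly}_1(M)$ has zero class in $H_1(\Sigma;\mathbb Z/2\mathbb Z)$, and $Z^0_{\mathrm{quadri}}(G^Q,J)$ is the sum of the weights of the configurations of $\mathcal M^0(G^Q)$. *)

theory Defs
  imports Complex_Main "HOL-Combinatorics.Permutations" "HOL-Combinatorics.Orbits"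
begin

text \<open>
  A finite graph cellularly embedded in a closed connected oriented surface is encoded by its
  rotation system (combinatorial map).  A dart is an oriented edge, based at its tail; \<open>flip\<close>
  reverses it, and \<open>rot\<close> sends it to the next dart counterclockwise around the tail.
  Loops, multiple edges, and edges with the same face on both sides are allowed.
\<close>

record 'd comb_map =
  darts :: "'d set"
  rot :: "'d \<Rightarrow> 'd"
  flip :: "'d \<Rightarrow> 'd"

text \<open>
  The last condition is connectedness of \<open>G\<close>, equivalently of the surface.  The condition
  \<open>darts G \<noteq> {}\<close> excludes only the one-vertex graph without edges on the sphere, which has
  no darts and no medial vertices.
\<close>

definition cellularly_embedded :: "('d, 'z) comb_map_scheme \<Rightarrow> bool" where
  "cellularly_embedded G \<longleftrightarrow>
     finite (darts G) \<and> darts G \<noteq> {} \<and>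
     rot G permutes darts G \<and> flip G permutes darts G \<and>
     (\<forall>d\<in>darts G. flip G d \<noteq> d \<and> flip G (flip G d) = d) \<and>
     (\<forall>d\<in>darts G. \<forall>d'\<in>darts G.
        (d, d') \<in> ({(x, rot G x) |x. x \<in> darts G} \<union> {(x, flip G x) |x. x \<in> darts G})\<^sup>*)"

definition edge_of :: "('d, 'z) comb_map_scheme \<Rightarrow> 'd \<Rightarrow> 'd set" where
  "edge_of G d = {d, flip G d}"

definition edges :: "('d, 'z) comb_map_scheme \<Rightarrow> 'd set set" where
  "edges G = edge_of G ` darts G"

definition vertices :: "('d, 'z) comb_map_scheme \<Rightarrow> 'd set set" where
  "vertices G = orbit (rot G) ` darts G"

text \<open>
  \<open>face_next G d\<close> is the dart following \<open>d\<close> when the face on the left of \<open>d\<close> is traversed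
  counterclockwise, so a face is the set of darts that have it on their left.
\<close>

definition face_next :: "('d, 'z) comb_map_scheme \<Rightarrow> 'd \<Rightarrow> 'd" where
  "face_next G = inv (rot G) \<circ> flip G"

definition faces :: "('d, 'z) comb_map_scheme \<Rightarrow> 'd set set" where
  "faces G = orbit (face_next G) ` darts G"

text \<open>
  The dual dart of \<open>d\<close> crosses \<open>d\<close> from its left face to its right face and carries the same
  name \<open>d\<close>.  Hence \<open>vertices (dual G) = faces G\<close>, the faces of \<open>dual G\<close> are the vertices
  of \<open>G\<close> (a vertex being represented by the darts pointing to it), and \<open>e\<close> and its dual edge are
  the same two-element set of darts: the bijection between \<open>edges G\<close> and \<open>edges (dual G)\<close> is
  the identity.
\<close>

definition dual :: "'d comb_map \<Rightarrow> 'd comb_map" where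
  "dual G = \<lparr> darts = darts G, rot = face_next G, flip = flip G \<rparr>"

text \<open>Counting darts makes a loop count twice at its vertex.\<close>

definition polygon_configs :: "('d, 'z) comb_map_scheme \<Rightarrow> 'd set set set" where
  "polygon_configs G =
     {P. P \<subseteq> edges G \<and> (\<forall>v\<in>vertices G. even (card {d \<in> v. edge_of G d \<in> P}))}"

text \<open>
  First homology of the surface with coefficients in the field with two elements, computed
  from the cellular chain complex given by \<open>G\<close>, where a chain mod 2 is a set of cells.  The cycles
  are the polygon configurations; \<open>face_boundary G S\<close> is the boundary of the 2-chain \<open>S\<close>.
\<close>

definition face_boundary :: "('d, 'z) comb_map_scheme \<Rightarrow> 'd set set \<Rightarrow> 'd set set" where
  "face_boundary G S = {e \<in> edges G. odd (card {d \<in> e. orbit (face_next G) d \<in> S})}"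

definition homology_class :: "('d, 'z) comb_map_scheme \<Rightarrow> 'd set set \<Rightarrow> 'd set set set" where
  "homology_class G P =
     {Q \<in> polygon_configs G. \<exists>S\<subseteq>faces G. (P - Q) \<union> (Q - P) = face_boundary G S}"

definition zero_polygon_configs :: "('d, 'z) comb_map_scheme \<Rightarrow> 'd set set set" where
  "zero_polygon_configs G = {P \<in> polygon_configs G. homology_class G P = homology_class G {}}"

definition disjoint_zero_pairs :: "'d comb_map \<Rightarrow> ('d set set \<times> 'd set set) set" where
  "disjoint_zero_pairs G =
     {(P, Q). P \<in> zero_polygon_configs G \<and> Q \<in> zero_polygon_configs (dual G) \<and> P \<inter> Q = {}}"

text \<open>
  The medial edges are indexed by darts: the medial edge \<open>c\<close> passes through the corner between
  \<open>c\<close> and \<open>rot G c\<close> and joins the medial vertices \<open>edge_of G c\<close> and \<open>edge_of G (rot G c)\<close>.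
  The corner \<open>(d, s)\<close> of the quadrangle of \<open>edge_of G d\<close> is the one in the sector at the tail of \<open>d\<close>
  on the side \<open>s\<close> of \<open>d\<close>.  The four corners are, counterclockwise,
  \<open>(d, Lft)\<close>, \<open>(d, Rgt)\<close>, \<open>(flip G d, Lft)\<close>, \<open>(flip G d, Rgt)\<close>, where
  \<open>(flip G d, Rgt)\<close> lies at the head of \<open>d\<close>, to the left of \<open>d\<close>.
\<close>

datatype side = Lft | Rgt

fun medial_edge_at :: "('d, 'z) comb_map_scheme \<Rightarrow> 'd \<times> side \<Rightarrow> 'd" where
  "medial_edge_at G (d, Lft) = d"
| "medial_edge_at G (d, Rgt) = inv (rot G) d"

definition quad_vertices :: "('d, 'z) comb_map_scheme \<Rightarrow> ('d \<times> side) set" where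
  "quad_vertices G = darts G \<times> UNIV"

text \<open>
  \<open>External c\<close> comes from the medial edge \<open>c\<close>; \<open>Parallel d\<close> is the internal edge parallel to
  \<open>edge_of G d\<close> on the left of \<open>d\<close>; \<open>Dual_parallel d\<close> is the internal edge parallel to the dual
  edge, on the tail side of \<open>d\<close>.  Distinct edges may have the same endpoints.
\<close>

datatype 'd quad_edge = External 'd | Parallel 'd | Dual_parallel 'd

fun quad_ends :: "('d, 'z) comb_map_scheme \<Rightarrow> 'd quad_edge \<Rightarrow> ('d \<times> side) set" where
  "quad_ends G (External c) = {(c, Lft), (rot G c, Rgt)}"
| "quad_ends G (Parallel d) = {(d, Lft), (flip G d, Rgt)}"
| "quad_ends G (Dual_parallel d) = {(d, Lft), (d, Rgt)}"

definition quad_edges :: "('d, 'z) comb_map_scheme \<Rightarrow> 'd quad_edge set" where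
  "quad_edges G = External ` darts G \<union> Parallel ` darts G \<union> Dual_parallel ` darts G"

definition dimer_configs :: "('d, 'z) comb_map_scheme \<Rightarrow> 'd quad_edge set set" where
  "dimer_configs G =
     {M. M \<subseteq> quad_edges G \<and> (\<forall>x\<in>quad_vertices G. \<exists>!q. q \<in> M \<and> x \<in> quad_ends G q)}"

fun quad_weight :: "('d, 'z) comb_map_scheme \<Rightarrow> ('d set \<Rightarrow> real) \<Rightarrow> 'd quad_edge \<Rightarrow> real" where
  "quad_weight G J (External c) = 1"
| "quad_weight G J (Parallel d) =
     2 * exp (- 2 * J (edge_of G d)) / (1 + exp (- 4 * J (edge_of G d)))"
| "quad_weight G J (Dual_parallel d) =
     (1 - exp (- 4 * J (edge_of G d))) / (1 + exp (- 4 * J (edge_of G d)))"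

definition dimer_weight ::
  "('d, 'z) comb_map_scheme \<Rightarrow> ('d set \<Rightarrow> real) \<Rightarrow> 'd quad_edge set \<Rightarrow> real" where
  "dimer_weight G J M = (\<Prod>q\<in>M. quad_weight G J q)"

text \<open>
  The sectors at the medial vertex \<open>e\<close> whose medial edge is present in \<open>M\<close>.  Sectors rather than
  medial edges are recorded, since a medial edge may be a loop at \<open>e\<close>.
\<close>

definition present_sectors ::
  "('d, 'z) comb_map_scheme \<Rightarrow> 'd quad_edge set \<Rightarrow> 'd set \<Rightarrow> ('d \<times> side) set" where
  "present_sectors G M e = {(d, s). d \<in> e \<and> External (medial_edge_at G (d, s)) \<in> M}"

text \<open>
  The edge \<open>e\<close> separates the two present from the two absent sectors when the present ones are
  exactly the two sectors on one side of \<open>e\<close>; likewise for the dual edge, whose two sides are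
  the two endpoints of \<open>e\<close>.
\<close>

definition Poly1 :: "('d, 'z) comb_map_scheme \<Rightarrow> 'd quad_edge set \<Rightarrow> 'd set set" where
  "Poly1 G M = {e \<in> edges G. \<exists>d\<in>e. present_sectors G M e = {(d, Lft), (flip G d, Rgt)}}"

definition Poly2 :: "'d comb_map \<Rightarrow> 'd quad_edge set \<Rightarrow> 'd set set" where
  "Poly2 G M = {e \<in> edges (dual G). \<exists>d\<in>e. present_sectors G M e = {(d, Lft), (d, Rgt)}}"

definition Poly :: "'d comb_map \<Rightarrow> 'd quad_edge set \<Rightarrow> 'd set set \<times> 'd set set" where
  "Poly G M = (Poly1 G M, Poly2 G M)"

definition zero_dimer_configs :: "('d, 'z) comb_map_scheme \<Rightarrow> 'd quad_edge set set" where
  "zero_dimer_configs G = {M \<in> dimer_configs G. Poly1 G M \<in> zero_polygon_configs G}"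

definition Z0_quadri :: "('d, 'z) comb_map_scheme \<Rightarrow> ('d set \<Rightarrow> real) \<Rightarrow> real" where
  "Z0_quadri G J = (\<Sum>M\<in>zero_dimer_configs G. dimer_weight G J M)"

end

theory Submission
  imports Defs
begin

text \<open>
  A dimer configuration determines the set \<open>X\<close> of medial edges that it contains. Medial edges are
  the corners of \<open>G\<close>, so \<open>X\<close> is a two-valued function on corners. The possible coverings of a
  single quadrangle show that turning around a vertex across an edge \<open>E\<close> changes this function
  exactly when \<open>E\<close> lies in \<open>Poly1\<close>, and turning around a face across the dual of \<open>E\<close> changes it
  exactly when \<open>E\<close> lies in \<open>Poly2\<close> (\<open>dimer_interfaces\<close>). Three facts about these relations between
  \<open>X\<close>, \<open>P\<close> and \<open>Q\<close>, called \<open>interfaces X P Q\<close> below, give the result.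

  \<^item> Homology. If \<open>P\<close> is the boundary of a set of faces and \<open>Q\<close> that of a set of dual faces, then
    the sum modulo 2 of the two indicator functions is such an \<open>X\<close> (\<open>interfaces_exist\<close>).
    Conversely, adding to \<open>X\<close> a set of faces with boundary \<open>P\<close> leaves a set of vertices, that is, of dual
    faces, whose boundary is \<open>Q\<close> (\<open>interfaces_zero_dual\<close>); so when \<open>Poly1\<close> has zero class, \<open>Poly2\<close> has zero
    class too.

  \<^item> Uniqueness. On a connected surface \<open>X\<close> is determined by \<open>P\<close> and \<open>Q\<close> up to complement
    (\<open>interfaces_two_solutions\<close>). This is the factor \<open>2\<close>.

  \<^item> Weights. Given \<open>X\<close>, the internal edges are forced at every quadrangle that has a present medial
    edge, with one edge of weight \<open>a\<close> at each edge of \<open>P\<close> and one of weight \<open>b\<close> at each edge of \<open>Q\<close>.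
    A quadrangle without present medial edges has two coverings, of weights \<open>a\<^sup>2\<close> and \<open>b\<^sup>2\<close>, and
    \<open>a\<^sup>2 + b\<^sup>2 = 1\<close>; so the configurations with medial edges \<open>X\<close> have the total weight
    of the product of \<open>a\<close> over \<open>P\<close> and of \<open>b\<close> over \<open>Q\<close> (\<open>weight_of_present_set\<close>).

  Every pair of disjoint zero configurations is attained because its fibre has positive weight.
\<close>

section \<open>Rotation systems and cellular boundaries\<close>

locale rotation_system =
  fixes G :: "'d comb_map"
  assumes finite_darts: "finite (darts G)"
    and rot_permutes: "rot G permutes darts G"
    and flip_permutes: "flip G permutes darts G"
    and flip_neq: "d \<in> darts G \<Longrightarrow> flip G d \<noteq> d"
    and flip_flip_darts: "d \<in> darts G \<Longrightarrow> flip G (flip G d) = d"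
begin

abbreviation D where "D \<equiv> darts G"
abbreviation r where "r \<equiv> rot G"
abbreviation r' where "r' \<equiv> inv (rot G)"
abbreviation f where "f \<equiv> flip G"
abbreviation \<phi> where "\<phi> \<equiv> face_next G"
abbreviation e where "e \<equiv> edge_of G"

lemma flip_flip [simp]: "f (f d) = d"
  using flip_flip_darts flip_permutes by (cases "d \<in> D") (auto simp: permutes_def)

lemma inv_flip: "inv f = f"
  by (rule inv_equality) auto

lemma rot_inv [simp]: "r (r' d) = d" "r' (r d) = d"
  using permutes_inverses[OF rot_permutes] by auto

lemma in_darts [simp]: "r d \<in> D \<longleftrightarrow> d \<in> D" "r' d \<in> D \<longleftrightarrow> d \<in> D" "f d \<in> D \<longleftrightarrow> d \<in> D"
  using permutes_in_image[OF rot_permutes] permutes_in_image[OF permutes_inv[OF rot_permutes]]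
    permutes_in_image[OF flip_permutes] by auto

lemma face_next_permutes: "\<phi> permutes D"
  unfolding face_next_def by (intro permutes_compose flip_permutes permutes_inv rot_permutes)

lemma face_next_apply: "\<phi> d = r' (f d)"
  by (simp add: face_next_def)

lemma face_next_in_darts [simp]: "\<phi> d \<in> D \<longleftrightarrow> d \<in> D"
  by (simp add: face_next_apply)

lemma face_next_flip: "\<phi> (f d) = r' d"
  by (simp add: face_next_apply)

lemma edge_of_flip [simp]: "e (f d) = e d"
  by (auto simp: edge_of_def)

lemma edge_of_in_edges [simp]: "d \<in> D \<Longrightarrow> e d \<in> edges G"
  by (auto simp: edges_def)

lemma edge_of_mem: "d \<in> e d" "d' \<in> e d \<longleftrightarrow> d' = d \<or> d' = f d"
  by (auto simp: edge_of_def)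

lemma edge_of_eq_iff: "e d = e d' \<longleftrightarrow> d = d' \<or> d = f d'"
  by (auto simp: edge_of_def doubleton_eq_iff)

lemma finite_edges: "finite (edges G)"
  by (simp add: edges_def finite_darts)

lemma edge_of_eqI: "E \<in> edges G \<Longrightarrow> d \<in> E \<Longrightarrow> d \<in> D \<and> E = e d"
  by (auto simp: edges_def edge_of_def)

text \<open>
  Two sets of edges may be compared dart by dart, which turns identities of sets of edges
  into identities of Boolean functions of a dart.
\<close>

lemma edge_set_eqI:
  assumes "P \<subseteq> edges G" "Q \<subseteq> edges G" "\<And>d. d \<in> D \<Longrightarrow> e d \<in> P \<longleftrightarrow> e d \<in> Q"
  shows "P = Q"
  using assms unfolding edges_def by blast

lemma dual_rotation_system: "rotation_system (dual G)"
  by unfold_locales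
    (auto simp: dual_def finite_darts face_next_permutes flip_permutes flip_neq)

lemma edge_of_dual [simp]: "edge_of (dual G) = e"
  by (simp add: fun_eq_iff edge_of_def dual_def)

lemma edges_dual [simp]: "edges (dual G) = edges G"
  by (simp add: edges_def dual_def edge_of_def)

lemma face_next_dual: "face_next (dual G) d = f (r (f d))"
proof -
  have "inv \<phi> = inv f \<circ> inv r'"
    unfolding face_next_def
    by (rule o_inv_distrib)
      (use permutes_bij[OF permutes_inv[OF rot_permutes]] permutes_bij[OF flip_permutes] in auto)
  then show ?thesis
    unfolding face_next_def[of "dual G"]
    by (simp add: dual_def inv_flip inv_inv_eq permutes_bij[OF rot_permutes])
qed

end

text \<open>
  For \<open>g\<close> permuting \<open>C\<close>, the function \<open>s\<close> is true as often before a step of \<open>g\<close> as after it, so it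
  changes from true to false as often as from false to true.
\<close>

lemma even_card_changes:
  fixes s :: "'a \<Rightarrow> bool"
  assumes "finite C" "g ` C = C"
  shows "even (card {d \<in> C. s d \<noteq> s (g d)})"
proof -
  let ?A = "{d \<in> C. s d}" and ?B = "{d \<in> C. s (g d)}"
  have inj: "inj_on g C"
    using assms by (simp add: eq_card_imp_inj_on)
  have fin: "finite ?A" "finite ?B"
    using assms(1) by simp_all
  have "g ` ?B = ?A"
  proof
    show "?A \<subseteq> g ` ?B"
    proof
      fix d assume d: "d \<in> ?A"
      then obtain d' where "d' \<in> C" "d = g d'"
        using assms(2) by (metis (no_types, lifting) imageE mem_Collect_eq)
      then show "d \<in> g ` ?B"
        using d by simp
    qed
  qed (use assms(2) in auto)
  then have "card ?A = card ?B"
    using card_image[OF inj_on_subset[OF inj], of ?B] by auto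
  moreover have "card ?A = card (?A \<inter> ?B) + card (?A - ?B)"
    by (rule card_Int_Diff[OF fin(1)])
  moreover have "card ?B = card (?A \<inter> ?B) + card (?B - ?A)"
    using card_Int_Diff[OF fin(2), of ?A] by (simp only: Int_commute)
  ultimately have "card (?A - ?B) = card (?B - ?A)"
    by linarith
  moreover have "{d \<in> C. s d \<noteq> s (g d)} = (?A - ?B) \<union> (?B - ?A)"
    by auto
  moreover have "card ((?A - ?B) \<union> (?B - ?A)) = card (?A - ?B) + card (?B - ?A)"
    using fin by (intro card_Un_disjoint) auto
  ultimately show ?thesis
    by simp
qed

lemma image_orbit_eq:
  assumes "g permutes S" "finite S"
  shows "g ` orbit g x = orbit g x" "inv g ` orbit g x = orbit g x"
proof -
  have p: "permutation g"
    using assms permutation_permutes by blast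
  have "orbit g (g x) = orbit g x"
    using permutation_orbit_step[OF p] .
  moreover have "g ` orbit g x = orbit g (g x)"
    by (rule orbit_inverse[OF permutation_self_in_orbit[OF p]]) simp
  ultimately show 1: "g ` orbit g x = orbit g x"
    by simp
  show "inv g ` orbit g x = orbit g x"
    using image_inv_f_f[OF permutes_inj[OF assms(1)], of "orbit g x"] by (simp only: 1)
qed

lemma constant_on_orbit:
  assumes "y \<in> orbit g x" "x \<in> S" "g permutes S" "\<And>z. z \<in> S \<Longrightarrow> s (g z) = s z"
  shows "s y = s x"
  using assms(1)
proof induction
  case base
  then show ?case using assms by simp
next
  case (step y)
  have "y \<in> S"
    using permutes_orbit_subset[OF assms(3,2)] step(1) by auto
  then show ?case using step assms(4) by simp
qed

context rotation_system
begin

text \<open>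
  For \<open>s\<close> constant along faces this is the boundary of the set of faces on which \<open>s\<close> holds; for
  \<open>s\<close> constant around vertices it is a coboundary of \<open>G\<close>, that is, a boundary of the dual.
\<close>

definition walls :: "('d \<Rightarrow> bool) \<Rightarrow> 'd set set" where
  "walls s = {e d |d. d \<in> D \<and> s d \<noteq> s (f d)}"

lemma walls_subset: "walls s \<subseteq> edges G"
  by (auto simp: walls_def)

lemma edge_of_in_walls: "d \<in> D \<Longrightarrow> e d \<in> walls s \<longleftrightarrow> s d \<noteq> s (f d)"
  by (auto simp: walls_def edge_of_eq_iff)

lemma vertex_props:
  assumes "v \<in> vertices G"
  shows "v \<subseteq> D" "finite v" "r' ` v = v"
proof -
  obtain d where d: "d \<in> D" "v = orbit r d"
    using assms by (auto simp: vertices_def)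
  show "v \<subseteq> D"
    unfolding d(2) by (rule permutes_orbit_subset[OF rot_permutes d(1)])
  then show "finite v"
    by (rule finite_subset[OF _ finite_darts])
  show "r' ` v = v"
    unfolding d(2) by (rule image_orbit_eq(2)[OF rot_permutes finite_darts])
qed

text \<open>
  Walking around a vertex crosses every incident edge, so an edge set that records the changes
  of some function on the corners is even at each vertex.
\<close>

lemma polygon_config_if_changes:
  fixes s :: "'d \<Rightarrow> bool"
  assumes "P \<subseteq> edges G" "\<And>d. d \<in> D \<Longrightarrow> e d \<in> P \<longleftrightarrow> s d \<noteq> s (r' d)"
  shows "P \<in> polygon_configs G"
proof -
  have "even (card {d \<in> v. e d \<in> P})" if v: "v \<in> vertices G" for v
  proof -
    have "{d \<in> v. e d \<in> P} = {d \<in> v. s d \<noteq> s (r' d)}"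
      using assms(2) vertex_props(1)[OF v] by blast
    then show ?thesis
      using even_card_changes[OF vertex_props(2,3)[OF v], of s] by simp
  qed
  then show ?thesis
    using assms(1) by (auto simp: polygon_configs_def)
qed

lemma walls_polygon:
  assumes "\<And>d. d \<in> D \<Longrightarrow> s (\<phi> d) = s d"
  shows "walls s \<in> polygon_configs G"
proof (rule polygon_config_if_changes[OF walls_subset])
  fix d assume "d \<in> D"
  then show "e d \<in> walls s \<longleftrightarrow> s d \<noteq> s (r' d)"
    using assms[of "f d"] by (simp add: edge_of_in_walls face_next_flip)
qed

lemma in_face_boundary:
  assumes "d \<in> D"
  shows "e d \<in> face_boundary G S \<longleftrightarrow> (orbit \<phi> d \<in> S) \<noteq> (orbit \<phi> (f d) \<in> S)"
proof -
  have "{d' \<in> e d. orbit \<phi> d' \<in> S} =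
      (if orbit \<phi> d \<in> S then {d} else {}) \<union> (if orbit \<phi> (f d) \<in> S then {f d} else {})"
    by (auto simp: edge_of_def)
  then show ?thesis
    using assms flip_neq[OF assms] by (auto simp: face_boundary_def card_insert_if)
qed

lemma face_boundary_subset: "face_boundary G S \<subseteq> edges G"
  by (auto simp: face_boundary_def)

text \<open>
  A 2-chain is a set of faces, hence a function of darts that is invariant along faces, and its
  boundary consists of the walls of that function.
\<close>

lemma boundary_iff_walls:
  "(\<exists>S\<subseteq>faces G. P = face_boundary G S) \<longleftrightarrow> (\<exists>s. (\<forall>d\<in>D. s (\<phi> d) = s d) \<and> P = walls s)"
proof
  have perm: "permutation \<phi>"
    using permutation_permutes face_next_permutes finite_darts by blast
  {
    assume "\<exists>S\<subseteq>faces G. P = face_boundary G S"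
    then obtain S where S: "S \<subseteq> faces G" "P = face_boundary G S" by blast
    have "P = walls (\<lambda>d. orbit \<phi> d \<in> S)"
      unfolding S(2)
      by (rule edge_set_eqI[OF face_boundary_subset walls_subset])
        (simp add: in_face_boundary edge_of_in_walls)
    then show "\<exists>s. (\<forall>d\<in>D. s (\<phi> d) = s d) \<and> P = walls s"
      by (intro exI[of _ "\<lambda>d. orbit \<phi> d \<in> S"]) (simp add: permutation_orbit_step[OF perm])
  next
    assume "\<exists>s. (\<forall>d\<in>D. s (\<phi> d) = s d) \<and> P = walls s"
    then obtain s where s: "\<And>d. d \<in> D \<Longrightarrow> s (\<phi> d) = s d" "P = walls s" by blast
    define S where "S = orbit \<phi> ` {d \<in> D. s d}"
    have S: "orbit \<phi> d \<in> S \<longleftrightarrow> s d" if d: "d \<in> D" for d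
    proof
      assume "orbit \<phi> d \<in> S"
      then obtain d' where d': "d' \<in> D" "s d'" "orbit \<phi> d = orbit \<phi> d'"
        by (auto simp: S_def)
      have "d \<in> orbit \<phi> d'"
        using permutation_self_in_orbit[OF perm, of d] d' by simp
      then show "s d"
        using constant_on_orbit[where g = \<phi> and s = s, OF _ d'(1) face_next_permutes s(1)] d'(2) by simp
    qed (use d in \<open>auto simp: S_def\<close>)
    have "P = face_boundary G S"
      unfolding s(2)
      by (rule edge_set_eqI[OF walls_subset face_boundary_subset])
        (simp add: in_face_boundary edge_of_in_walls S)
    moreover have "S \<subseteq> faces G"
      by (auto simp: S_def faces_def)
    ultimately show "\<exists>S\<subseteq>faces G. P = face_boundary G S" by blast
  }
qed

definition boundaries :: "'d set set set" where
  "boundaries = walls ` {s. \<forall>d\<in>D. s (\<phi> d) = s d}"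

lemma boundaries_iff: "P \<in> boundaries \<longleftrightarrow> (\<exists>s. (\<forall>d\<in>D. s (\<phi> d) = s d) \<and> P = walls s)"
  unfolding boundaries_def image_iff by simp

lemma sym_diff_walls: "sym_diff (walls s) (walls t) = walls (\<lambda>d. s d \<noteq> t d)"
proof (rule edge_set_eqI)
  show "sym_diff (walls s) (walls t) \<subseteq> edges G"
    using walls_subset[of s] walls_subset[of t] by blast
  fix d assume d: "d \<in> D"
  show "e d \<in> sym_diff (walls s) (walls t) \<longleftrightarrow> e d \<in> walls (\<lambda>d. s d \<noteq> t d)"
    unfolding Un_iff Diff_iff edge_of_in_walls[OF d] by argo
qed (rule walls_subset)

lemma sym_diff_boundaries:
  assumes "P \<in> boundaries" "Q \<in> boundaries"
  shows "sym_diff P Q \<in> boundaries"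
proof -
  obtain s where s: "\<forall>d\<in>D. s (\<phi> d) = s d" "P = walls s"
    using assms(1) unfolding boundaries_iff by (elim exE conjE)
  obtain t where t: "\<forall>d\<in>D. t (\<phi> d) = t d" "Q = walls t"
    using assms(2) unfolding boundaries_iff by (elim exE conjE)
  have "\<forall>d\<in>D. (s (\<phi> d) \<noteq> t (\<phi> d)) = (s d \<noteq> t d)"
    using s(1) t(1) by simp
  then show ?thesis
    unfolding boundaries_iff s(2) t(2) sym_diff_walls
    by (intro exI[of _ "\<lambda>d. s d \<noteq> t d"] conjI refl)
qed

lemma empty_in_boundaries: "{} \<in> boundaries"
proof -
  have "walls (\<lambda>_. True) = {}"
    by (simp add: walls_def)
  then show ?thesis
    unfolding boundaries_iff by (intro exI[of _ "\<lambda>_. True"]) simp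
qed

text \<open>
  The classes of a polygon configuration and of the empty one coincide exactly when it is a
  boundary, since boundaries form a group under symmetric difference.
\<close>

lemma zero_polygon_configs_eq_boundaries: "zero_polygon_configs G = boundaries"
proof (intro set_eqI iffI)
  have cls: "Q \<in> homology_class G P \<longleftrightarrow> Q \<in> polygon_configs G \<and> sym_diff P Q \<in> boundaries" for P Q
    unfolding homology_class_def boundary_iff_walls boundaries_iff mem_Collect_eq ..
  have cls_empty: "Q \<in> homology_class G {} \<longleftrightarrow> Q \<in> polygon_configs G \<and> Q \<in> boundaries" for Q
    by (simp add: cls)
  fix P
  {
    assume "P \<in> zero_polygon_configs G"
    then have P: "P \<in> polygon_configs G" "homology_class G P = homology_class G {}"
      by (simp_all add: zero_polygon_configs_def)
    have "P \<in> homology_class G P"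
      using P(1) empty_in_boundaries by (simp add: cls)
    then show "P \<in> boundaries"
      unfolding P(2) cls_empty by simp
  next
    assume B: "P \<in> boundaries"
    have "sym_diff P Q \<in> boundaries \<longleftrightarrow> Q \<in> boundaries" for Q
    proof
      \<comment> \<open>Adding the boundary \<open>P\<close> a second time recovers \<open>Q\<close>.\<close>
      assume "sym_diff P Q \<in> boundaries"
      then have "sym_diff P (sym_diff P Q) \<in> boundaries"
        by (rule sym_diff_boundaries[OF B])
      also have "sym_diff P (sym_diff P Q) = Q" by blast
      finally show "Q \<in> boundaries" .
    qed (rule sym_diff_boundaries[OF B])
    then have "homology_class G P = homology_class G {}"
      by (intro set_eqI) (simp only: cls Diff_empty empty_Diff Un_empty_left)
    moreover have "P \<in> polygon_configs G"
    proof -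
      obtain s where "\<forall>d\<in>D. s (\<phi> d) = s d" "P = walls s"
        using B unfolding boundaries_iff by (elim exE conjE)
      then show ?thesis
        using walls_polygon[of s] by simp
    qed
    ultimately show "P \<in> zero_polygon_configs G"
      by (simp add: zero_polygon_configs_def)
  }
qed

lemmas zero_polygon_configs_iff_walls =
  boundaries_iff[folded zero_polygon_configs_eq_boundaries]

text \<open>
  A dart of the dual representing a vertex of \<open>G\<close> points towards that vertex, so functions that are
  invariant along the faces of the dual become functions invariant around the vertices of \<open>G\<close>
  after composition with the reversal of darts.
\<close>

lemma zero_polygon_configs_dual_iff_walls:
  "Q \<in> zero_polygon_configs (dual G) \<longleftrightarrow> (\<exists>t. (\<forall>d\<in>D. t (r d) = t d) \<and> Q = walls t)"
proof -
  interpret dual: rotation_system "dual G" by (rule dual_rotation_system)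
  have simps: "darts (dual G) = D" "flip (dual G) = f"
    by (simp_all add: dual_def)
  have walls: "dual.walls s = walls (\<lambda>d. s (f d))" for s
    by (auto simp: dual.walls_def walls_def simps)
  have "Q \<in> zero_polygon_configs (dual G) \<longleftrightarrow>
      (\<exists>s. (\<forall>d\<in>D. s (f (r (f d))) = s d) \<and> Q = walls (\<lambda>d. s (f d)))"
    by (simp add: dual.zero_polygon_configs_iff_walls simps walls face_next_dual)
  also have "\<dots> \<longleftrightarrow> (\<exists>t. (\<forall>d\<in>D. t (r d) = t d) \<and> Q = walls t)"
  proof
    assume "\<exists>s. (\<forall>d\<in>D. s (f (r (f d))) = s d) \<and> Q = walls (\<lambda>d. s (f d))"
    then obtain s where s: "\<And>d. d \<in> D \<Longrightarrow> s (f (r (f d))) = s d" "Q = walls (\<lambda>d. s (f d))"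
      by blast
    then show "\<exists>t. (\<forall>d\<in>D. t (r d) = t d) \<and> Q = walls t"
      using s(1)[of "f _"] by (intro exI[of _ "\<lambda>d. s (f d)"]) simp
  next
    assume "\<exists>t. (\<forall>d\<in>D. t (r d) = t d) \<and> Q = walls t"
    then obtain t where "\<And>d. d \<in> D \<Longrightarrow> t (r d) = t d" "Q = walls t"
      by blast
    then show "\<exists>s. (\<forall>d\<in>D. s (f (r (f d))) = s d) \<and> Q = walls (\<lambda>d. s (f d))"
      by (intro exI[of _ "\<lambda>d. t (f d)"]) simp
  qed
  finally show ?thesis .
qed

section \<open>Configurations of present medial edges\<close>

text \<open>
  \<open>X\<close> is a set of medial edges, that is, of corners of \<open>G\<close>. Turning around the tail of \<open>d\<close> from the
  corner \<open>r' d\<close> to the corner \<open>d\<close> crosses the edge of \<open>d\<close>; following the face on the left of \<open>d\<close>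
  from the corner \<open>d\<close> to the corner \<open>\<phi> d\<close> crosses its dual edge.
\<close>

definition interfaces :: "'d set \<Rightarrow> 'd set set \<Rightarrow> 'd set set \<Rightarrow> bool" where
  "interfaces X P Q \<longleftrightarrow> P \<subseteq> edges G \<and> Q \<subseteq> edges G \<and>
     (\<forall>d\<in>D. (e d \<in> P \<longleftrightarrow> (d \<in> X) \<noteq> (r' d \<in> X)) \<and> (e d \<in> Q \<longleftrightarrow> (d \<in> X) \<noteq> (\<phi> d \<in> X)))"

lemma interfacesD:
  assumes "interfaces X P Q" "d \<in> D"
  shows "e d \<in> P \<longleftrightarrow> (d \<in> X) \<noteq> (r' d \<in> X)" "e d \<in> Q \<longleftrightarrow> (d \<in> X) \<noteq> (\<phi> d \<in> X)"
  using assms by (auto simp: interfaces_def)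

lemma interfaces_unique:
  assumes "interfaces X P Q" "interfaces X P' Q'"
  shows "P' = P" "Q' = Q"
proof -
  have "P \<subseteq> edges G" "Q \<subseteq> edges G" "P' \<subseteq> edges G" "Q' \<subseteq> edges G"
    using assms by (simp_all add: interfaces_def)
  then show "P' = P" "Q' = Q"
    by - ((rule edge_set_eqI, assumption, assumption,
        simp only: interfacesD[OF assms(1)] interfacesD[OF assms(2)])+)
qed

lemma interfaces_Compl: "interfaces X P Q \<Longrightarrow> interfaces (D - X) P Q"
  unfolding interfaces_def by simp

text \<open>
  The set \<open>X\<close> exhibits \<open>P\<close> and \<open>Q\<close> as homologous on the surface. Concretely, add modulo 2 to the
  indicator of \<open>X\<close> the indicator of a set of faces with boundary \<open>P\<close>. The sum does not change when
  turning around a vertex, so it is the indicator of a set of dual faces, and the changes of \<open>X\<close>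
  along the faces of \<open>G\<close> show that its boundary is \<open>Q\<close>.
\<close>

lemma interfaces_zero_dual:
  assumes X: "interfaces X P Q" and P: "P \<in> zero_polygon_configs G"
  shows "Q \<in> zero_polygon_configs (dual G)"
proof -
  obtain s where s: "\<And>d. d \<in> D \<Longrightarrow> s (\<phi> d) = s d" "P = walls s"
    using P by (auto simp: zero_polygon_configs_iff_walls)
  define t where "t d \<longleftrightarrow> (d \<in> X) \<noteq> s d" for d
  have s_inv: "s (r' d) = s (f d)" if "d \<in> D" for d
    using s(1)[of "f d"] that by (simp add: face_next_flip)
  have inv: "t (r' d) = t d" if "d \<in> D" for d
    using interfacesD(1)[OF X that] s_inv[OF that] that by (auto simp: t_def s(2) edge_of_in_walls)
  have "t (r d) = t d" if "d \<in> D" for d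
    using inv[of "r d"] that by simp
  moreover have "Q = walls t"
  proof (rule edge_set_eqI[OF _ walls_subset])
    show "Q \<subseteq> edges G" using X by (simp add: interfaces_def)
    fix d assume d: "d \<in> D"
    have "t (f d) = t (\<phi> d)"
      using inv[of "f d"] d by (simp add: face_next_apply)
    then show "e d \<in> Q \<longleftrightarrow> e d \<in> walls t"
      using interfacesD(2)[OF X d] s(1)[OF d] d by (auto simp: t_def edge_of_in_walls)
  qed
  ultimately show ?thesis
    unfolding zero_polygon_configs_dual_iff_walls by blast
qed

text \<open>
  In the sum modulo 2 of an indicator \<open>s\<close> of faces and an indicator \<open>t\<close> of vertices, only \<open>s\<close> changes
  around a vertex and only \<open>t\<close> changes along a face.
\<close>

lemma interfaces_exist:
  assumes P: "P \<in> zero_polygon_configs G" and Q: "Q \<in> zero_polygon_configs (dual G)"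
  shows "\<exists>X\<subseteq>D. interfaces X P Q"
proof -
  obtain s where s: "\<And>d. d \<in> D \<Longrightarrow> s (\<phi> d) = s d" "P = walls s"
    using P by (auto simp: zero_polygon_configs_iff_walls)
  obtain t where t: "\<And>d. d \<in> D \<Longrightarrow> t (r d) = t d" "Q = walls t"
    using Q by (auto simp: zero_polygon_configs_dual_iff_walls)
  have s_inv: "s (r' d) = s (f d)" if "d \<in> D" for d
    using s(1)[of "f d"] that by (simp add: face_next_flip)
  have t_inv: "t (r' d) = t d" if "d \<in> D" for d
    using t(1)[of "r' d"] that by simp
  have "interfaces {d \<in> D. s d \<noteq> t d} P Q"
    unfolding interfaces_def
  proof (intro conjI ballI)
    show "P \<subseteq> edges G" "Q \<subseteq> edges G"
      unfolding s(2) t(2) by (rule walls_subset)+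
    fix d assume d: "d \<in> D"
    have "t (\<phi> d) = t (f d)"
      using t_inv[of "f d"] d by (simp add: face_next_apply)
    then show "e d \<in> P \<longleftrightarrow> (d \<in> {d \<in> D. s d \<noteq> t d}) \<noteq> (r' d \<in> {d \<in> D. s d \<noteq> t d})"
      "e d \<in> Q \<longleftrightarrow> (d \<in> {d \<in> D. s d \<noteq> t d}) \<noteq> (\<phi> d \<in> {d \<in> D. s d \<noteq> t d})"
      unfolding s(2) t(2) edge_of_in_walls[OF d]
      using d s_inv[OF d] t_inv[OF d] s(1)[OF d] by (simp_all, argo+)
  qed
  then show ?thesis
    by (intro exI[of _ "{d \<in> D. s d \<noteq> t d}"]) auto
qed

section \<open>Dimer configurations and their present medial edges\<close>

definition present :: "'d quad_edge set \<Rightarrow> 'd set" where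
  "present M = {d. External d \<in> M}"

definition exactly_one :: "bool \<Rightarrow> bool \<Rightarrow> bool \<Rightarrow> bool" where
  "exactly_one a b c \<longleftrightarrow> (a \<or> b \<or> c) \<and> \<not> (a \<and> b) \<and> \<not> (a \<and> c) \<and> \<not> (b \<and> c)"

lemma dimer_configs_iff:
  "M \<in> dimer_configs G \<longleftrightarrow> M \<subseteq> quad_edges G \<and>
     (\<forall>d\<in>D. exactly_one (d \<in> present M) (Parallel d \<in> M) (Dual_parallel d \<in> M) \<and>
            exactly_one (r' d \<in> present M) (Parallel (f d) \<in> M) (Dual_parallel d \<in> M))"
proof -
  have ex1: "(\<exists>!q. q \<in> M \<and> (q = a \<or> q = b \<or> q = c)) \<longleftrightarrow> exactly_one (a \<in> M) (b \<in> M) (c \<in> M)"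
    if "a \<noteq> b" "a \<noteq> c" "b \<noteq> c" for a b c :: "'d quad_edge"
  proof -
    have "(\<exists>!q. q \<in> M \<and> (q = a \<or> q = b \<or> q = c)) \<longleftrightarrow>
        (\<exists>q. q \<in> M \<and> (q = a \<or> q = b \<or> q = c)) \<and>
        (\<forall>q q'. q \<in> M \<and> (q = a \<or> q = b \<or> q = c) \<longrightarrow> q' \<in> M \<and> (q' = a \<or> q' = b \<or> q' = c) \<longrightarrow> q = q')"
      by blast
    also have "\<dots> \<longleftrightarrow> exactly_one (a \<in> M) (b \<in> M) (c \<in> M)"
      unfolding exactly_one_def using that by blast
    finally show ?thesis .
  qed
  have "(d, Lft) \<in> quad_ends G q \<longleftrightarrow> q = External d \<or> q = Parallel d \<or> q = Dual_parallel d" for d q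
    by (cases q) auto
  then have L: "(\<exists>!q. q \<in> M \<and> (d, Lft) \<in> quad_ends G q) \<longleftrightarrow>
      exactly_one (d \<in> present M) (Parallel d \<in> M) (Dual_parallel d \<in> M)" for d
    by (simp add: ex1 present_def)
  have "(d, Rgt) \<in> quad_ends G q \<longleftrightarrow> q = External (r' d) \<or> q = Parallel (f d) \<or> q = Dual_parallel d" for d q
    by (cases q) auto
  then have R: "(\<exists>!q. q \<in> M \<and> (d, Rgt) \<in> quad_ends G q) \<longleftrightarrow>
      exactly_one (r' d \<in> present M) (Parallel (f d) \<in> M) (Dual_parallel d \<in> M)" for d
    by (simp add: ex1 present_def)
  have sides: "(UNIV :: side set) = {Lft, Rgt}"
    using side.exhaust by blast
  have "(\<forall>x\<in>quad_vertices G. A x) \<longleftrightarrow> (\<forall>d\<in>D. A (d, Lft) \<and> A (d, Rgt))" for A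
    unfolding quad_vertices_def sides by blast
  then show ?thesis
    unfolding dimer_configs_def by (simp add: L R)
qed

lemma dimer_corners:
  assumes "M \<in> dimer_configs G" "d \<in> D"
  shows "exactly_one (d \<in> present M) (Parallel d \<in> M) (Dual_parallel d \<in> M)"
    and "exactly_one (r' d \<in> present M) (Parallel (f d) \<in> M) (Dual_parallel d \<in> M)"
    and "exactly_one (f d \<in> present M) (Parallel (f d) \<in> M) (Dual_parallel (f d) \<in> M)"
    and "exactly_one (\<phi> d \<in> present M) (Parallel d \<in> M) (Dual_parallel (f d) \<in> M)"
  using assms(1)[unfolded dimer_configs_iff, THEN conjunct2, rule_format, OF assms(2)]
    assms(1)[unfolded dimer_configs_iff, THEN conjunct2, rule_format, of "f d"] assms(2)
  by (simp_all add: face_next_apply)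

lemma finite_quad_edges: "finite (quad_edges G)"
  by (simp add: quad_edges_def finite_darts)

lemma finite_dimer_configs: "finite (dimer_configs G)"
  by (rule finite_subset[of _ "Pow (quad_edges G)"])
    (auto simp: dimer_configs_def finite_quad_edges)

lemma present_subset: "M \<in> dimer_configs G \<Longrightarrow> present M \<subseteq> D"
  by (auto simp: dimer_configs_def quad_edges_def present_def)

lemma in_present_sectors:
  "(d', Lft) \<in> present_sectors G M E \<longleftrightarrow> d' \<in> E \<and> d' \<in> present M"
  "(d', Rgt) \<in> present_sectors G M E \<longleftrightarrow> d' \<in> E \<and> r' d' \<in> present M"
  by (simp_all add: present_sectors_def present_def)

text \<open>
  In the definitions of \<open>Poly1\<close> and \<open>Poly2\<close> the two sectors on one side of the edge, or of its dual
  edge, play the part of \<open>p\<close> and \<open>q\<close>, and those on the other side the part of \<open>u\<close> and \<open>v\<close>.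
\<close>

lemma present_sectors_eq_pair_iff:
  assumes "{p, q, u, v} = e d \<times> UNIV" "u \<notin> {p, q}" "v \<notin> {p, q}"
  shows "present_sectors G M (e d) = {p, q} \<longleftrightarrow>
    p \<in> present_sectors G M (e d) \<and> q \<in> present_sectors G M (e d) \<and>
    u \<notin> present_sectors G M (e d) \<and> v \<notin> present_sectors G M (e d)"
proof -
  have "present_sectors G M (e d) \<subseteq> {p, q, u, v}"
    unfolding assms(1) by (auto simp: present_sectors_def)
  then show ?thesis
    using assms(2,3) by blast
qed

text \<open>
  Internal edges join consecutive corners, so the sectors with a present medial edge are none, all,
  or two consecutive ones. In the last case they are separated by the edge or by the dual edge. Hence
  two sectors at the same endpoint of the edge are in different states exactly when the edge is
  selected, and two sectors on the same side of it exactly when the dual edge is selected.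
\<close>

lemma dimer_interfaces:
  assumes M: "M \<in> dimer_configs G"
  shows "interfaces (present M) (Poly1 G M) (Poly2 G M)" and "Poly1 G M \<inter> Poly2 G M = {}"
proof -
  have P: "e d \<in> Poly1 G M \<longleftrightarrow> (d \<in> present M) \<noteq> (r' d \<in> present M)"
    and Q: "e d \<in> Poly2 G M \<longleftrightarrow> (d \<in> present M) \<noteq> (\<phi> d \<in> present M)"
    and disj: "\<not> (e d \<in> Poly1 G M \<and> e d \<in> Poly2 G M)" if d: "d \<in> D" for d
  proof -
    note local_rule = dimer_corners[OF M d]
    have mem: "(\<exists>d'\<in>e d. A d') \<longleftrightarrow> A d \<or> A (f d)" for A
      by (auto simp: edge_of_def)
    have neq: "f d \<noteq> d" "d \<noteq> f d"
      using flip_neq[OF d] by auto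
    have corners: "e d \<times> UNIV = {(d, Lft), (f d, Rgt), (f d, Lft), (d, Rgt)}"
      by (auto simp: edge_of_def intro: side.exhaust)
    note sectors = edge_of_mem in_present_sectors face_next_apply
    have sets: "present_sectors G M (e d) = {(d, Lft), (f d, Rgt)} \<longleftrightarrow>
          d \<in> present M \<and> \<phi> d \<in> present M \<and> f d \<notin> present M \<and> r' d \<notin> present M"
      "present_sectors G M (e d) = {(f d, Lft), (d, Rgt)} \<longleftrightarrow>
          d \<notin> present M \<and> \<phi> d \<notin> present M \<and> f d \<in> present M \<and> r' d \<in> present M"
      "present_sectors G M (e d) = {(d, Lft), (d, Rgt)} \<longleftrightarrow>
          d \<in> present M \<and> r' d \<in> present M \<and> f d \<notin> present M \<and> \<phi> d \<notin> present M"
      "present_sectors G M (e d) = {(f d, Lft), (f d, Rgt)} \<longleftrightarrow>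
          d \<notin> present M \<and> r' d \<notin> present M \<and> f d \<in> present M \<and> \<phi> d \<in> present M"
      using neq present_sectors_eq_pair_iff[of "(d, Lft)" "(f d, Rgt)" "(f d, Lft)" "(d, Rgt)" d M]
        present_sectors_eq_pair_iff[of "(f d, Lft)" "(d, Rgt)" "(d, Lft)" "(f d, Rgt)" d M]
        present_sectors_eq_pair_iff[of "(d, Lft)" "(d, Rgt)" "(f d, Lft)" "(f d, Rgt)" d M]
        present_sectors_eq_pair_iff[of "(f d, Lft)" "(f d, Rgt)" "(d, Lft)" "(d, Rgt)" d M]
      by (simp_all add: corners sectors insert_commute conj_commute conj_left_commute)
    have 1: "e d \<in> Poly1 G M \<longleftrightarrow>
        d \<in> present M \<and> \<phi> d \<in> present M \<and> f d \<notin> present M \<and> r' d \<notin> present M \<or>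
        d \<notin> present M \<and> \<phi> d \<notin> present M \<and> f d \<in> present M \<and> r' d \<in> present M"
      using d by (simp add: Poly1_def mem sets)
    have 2: "e d \<in> Poly2 G M \<longleftrightarrow>
        d \<in> present M \<and> r' d \<in> present M \<and> f d \<notin> present M \<and> \<phi> d \<notin> present M \<or>
        d \<notin> present M \<and> r' d \<notin> present M \<and> f d \<in> present M \<and> \<phi> d \<in> present M"
      using d by (simp add: Poly2_def mem sets)
    show "e d \<in> Poly1 G M \<longleftrightarrow> (d \<in> present M) \<noteq> (r' d \<in> present M)"
      using local_rule unfolding 1 exactly_one_def by argo
    show "e d \<in> Poly2 G M \<longleftrightarrow> (d \<in> present M) \<noteq> (\<phi> d \<in> present M)"
      using local_rule unfolding 2 exactly_one_def by argo
    show "\<not> (e d \<in> Poly1 G M \<and> e d \<in> Poly2 G M)"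
      unfolding 1 2 by argo
  qed
  have subset: "Poly1 G M \<subseteq> edges G" "Poly2 G M \<subseteq> edges G"
    by (auto simp: Poly1_def Poly2_def)
  show "interfaces (present M) (Poly1 G M) (Poly2 G M)"
    unfolding interfaces_def using subset P Q by blast
  show "Poly1 G M \<inter> Poly2 G M = {}"
    using subset disj unfolding edges_def by blast
qed

lemma Poly_eq_iff_interfaces:
  assumes "M \<in> dimer_configs G"
  shows "Poly G M = (P, Q) \<longleftrightarrow> interfaces (present M) P Q"
  unfolding Poly_def prod.inject
  using dimer_interfaces(1)[OF assms] interfaces_unique[OF _ dimer_interfaces(1)[OF assms]] by blast

section \<open>Summation over the internal edges\<close>

text \<open>
  The quadrangles at which no medial edge is present: each of them can be covered by its two
  internal edges parallel to the edge or by the two parallel to the dual edge, while the internal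
  edges at all other quadrangles are determined by the present medial edges.
\<close>

definition free_edges :: "'d set \<Rightarrow> 'd set set \<Rightarrow> 'd set set \<Rightarrow> 'd set set" where
  "free_edges X P Q = {E \<in> edges G. E \<notin> P \<and> E \<notin> Q \<and> E \<inter> X = {}}"

text \<open>
  \<open>K\<close> is the set of free quadrangles covered parallel to their edge. At the edges of \<open>P\<close> and \<open>Q\<close> the
  remaining internal edge joins the two absent corners. In either case exactly one dart \<open>d\<close> of the
  edge is outside \<open>X\<close>, and the corner \<open>(d, Lft)\<close> belongs to that internal edge.
\<close>

definition completion ::
  "'d set \<Rightarrow> 'd set set \<Rightarrow> 'd set set \<Rightarrow> 'd set set \<Rightarrow> 'd quad_edge set" where
  "completion X P Q K =
     External ` X \<union>
     Parallel ` (\<Union>K \<union> {d \<in> D - X. e d \<in> P}) \<union>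
     Dual_parallel ` (\<Union>(free_edges X P Q - K) \<union> {d \<in> D - X. e d \<in> Q})"

lemma in_completion:
  "External d \<in> completion X P Q K \<longleftrightarrow> d \<in> X"
  "Parallel d \<in> completion X P Q K \<longleftrightarrow> d \<in> \<Union>K \<or> d \<in> D \<and> d \<notin> X \<and> e d \<in> P"
  "Dual_parallel d \<in> completion X P Q K \<longleftrightarrow>
     d \<in> \<Union>(free_edges X P Q - K) \<or> d \<in> D \<and> d \<notin> X \<and> e d \<in> Q"
  by (auto simp: completion_def)

lemma in_Union_edges:
  assumes "K \<subseteq> edges G"
  shows "d \<in> \<Union>K \<longleftrightarrow> d \<in> D \<and> e d \<in> K"
  using assms edge_of_eqI edge_of_mem(1) by blast

lemma free_edges_subset: "free_edges X P Q \<subseteq> edges G"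
  by (auto simp: free_edges_def)

lemma in_Union_free_edges:
  "d \<in> \<Union>(free_edges X P Q - K) \<longleftrightarrow> d \<in> D \<and> e d \<in> free_edges X P Q \<and> e d \<notin> K"
proof -
  have sub: "free_edges X P Q - K \<subseteq> edges G"
    using free_edges_subset by blast
  show ?thesis
    unfolding in_Union_edges[OF sub] Diff_iff ..
qed

lemma edge_of_in_free_edges:
  "d \<in> D \<Longrightarrow> e d \<in> free_edges X P Q \<longleftrightarrow> e d \<notin> P \<and> e d \<notin> Q \<and> d \<notin> X \<and> f d \<notin> X"
  using edge_of_in_edges[of d] by (auto simp: free_edges_def edge_of_def)

text \<open>
  The corners in the four sectors at the edge of \<open>d\<close> are \<open>d\<close>, \<open>r' d\<close>, \<open>f d\<close> and \<open>\<phi> d\<close>. The rules for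
  the two darts of the edge together relate all consecutive ones.
\<close>

lemma interfaces_edge:
  assumes "interfaces X P Q" "d \<in> D"
  shows "e d \<in> P \<longleftrightarrow> (d \<in> X) \<noteq> (r' d \<in> X)" "e d \<in> Q \<longleftrightarrow> (d \<in> X) \<noteq> (\<phi> d \<in> X)"
    "e d \<in> P \<longleftrightarrow> (f d \<in> X) \<noteq> (\<phi> d \<in> X)" "e d \<in> Q \<longleftrightarrow> (f d \<in> X) \<noteq> (r' d \<in> X)"
  using interfacesD[OF assms(1), of d] interfacesD[OF assms(1), of "f d"] assms(2)
  by (simp_all add: face_next_apply)

text \<open>
  The membership conditions of dimer configurations and of completions involve one quadrangle at a
  time, so the verification is propositional in the states of the four sectors and the four internal
  edges of a quadrangle.
\<close>

lemma completions:
  assumes X: "interfaces X P Q" "X \<subseteq> D" and disj: "P \<inter> Q = {}"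
  shows "bij_betw (completion X P Q) (Pow (free_edges X P Q)) {M \<in> dimer_configs G. present M = X}"
proof (rule bij_betw_byWitness[where f' = "\<lambda>M. {E \<in> free_edges X P Q. Parallel ` E \<subseteq> M}"])
  let ?F = "free_edges X P Q"
  have FE: "K \<subseteq> edges G" if "K \<in> Pow ?F" for K
    using that free_edges_subset by blast
  have disj': "\<not> (e d \<in> P \<and> e d \<in> Q)" for d
    using disj by blast
  have quad: "exactly_one (d \<in> X) (Parallel d \<in> completion X P Q K) (Dual_parallel d \<in> completion X P Q K)"
    "exactly_one (r' d \<in> X) (Parallel (f d) \<in> completion X P Q K) (Dual_parallel d \<in> completion X P Q K)"
    if K: "K \<in> Pow ?F" and d: "d \<in> D" for K d
  proof -
    have 1: "d \<in> \<Union>K \<longleftrightarrow> e d \<in> K" "f d \<in> \<Union>K \<longleftrightarrow> e d \<in> K"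
      "d \<in> \<Union>(?F - K) \<longleftrightarrow> e d \<in> ?F \<and> e d \<notin> K"
      unfolding in_Union_free_edges in_Union_edges[OF FE[OF K]] using d by simp_all
    have 2: "e d \<in> K \<longrightarrow> e d \<in> ?F" using K by blast
    note rules = 2[unfolded edge_of_in_free_edges[OF d]] interfaces_edge[OF X(1) d] disj'[of d]
    show "exactly_one (d \<in> X) (Parallel d \<in> completion X P Q K) (Dual_parallel d \<in> completion X P Q K)"
      unfolding in_completion 1 edge_of_in_free_edges[OF d] exactly_one_def
      using rules d by argo
    show "exactly_one (r' d \<in> X) (Parallel (f d) \<in> completion X P Q K) (Dual_parallel d \<in> completion X P Q K)"
      unfolding in_completion 1 edge_of_in_free_edges[OF d] exactly_one_def edge_of_flip in_darts
      using rules d by argo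
  qed
  have present_completion: "present (completion X P Q K) = X" for K
    by (simp add: present_def in_completion)
  show "completion X P Q ` Pow ?F \<subseteq> {M \<in> dimer_configs G. present M = X}"
  proof
    fix N assume "N \<in> completion X P Q ` Pow ?F"
    then obtain K where K: "K \<in> Pow ?F" "N = completion X P Q K"
      by blast
    then have "\<Union>K \<subseteq> D" "\<Union>(?F - K) \<subseteq> D"
      using in_Union_edges[OF FE[OF K(1)]] in_Union_free_edges by blast+
    then have "completion X P Q K \<subseteq> quad_edges G"
      using X(2) unfolding completion_def quad_edges_def by blast
    then have "completion X P Q K \<in> dimer_configs G"
      using quad[OF K(1)] unfolding dimer_configs_iff present_completion by blast
    then show "N \<in> {M \<in> dimer_configs G. present M = X}"
      by (simp add: K(2) present_completion)
  qed
  show "\<forall>K\<in>Pow ?F. {E \<in> ?F. Parallel ` E \<subseteq> completion X P Q K} = K"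
  proof
    fix K assume K: "K \<in> Pow ?F"
    have "Parallel ` E \<subseteq> completion X P Q K \<longleftrightarrow> E \<in> K" if E: "E \<in> ?F" for E
    proof -
      obtain d where d: "d \<in> D" "E = e d"
        using E free_edges_subset unfolding edges_def by blast
      have "Parallel ` e d \<subseteq> completion X P Q K \<longleftrightarrow>
          Parallel d \<in> completion X P Q K \<and> Parallel (f d) \<in> completion X P Q K"
        by (simp add: edge_of_def)
      moreover have "e d \<notin> P"
        using E d edge_of_in_free_edges[OF d(1)] by simp
      ultimately show ?thesis
        unfolding d(2) in_completion in_Union_edges[OF FE[OF K]] edge_of_flip in_darts
        using d(1) by simp
    qed
    then have "{E \<in> ?F. Parallel ` E \<subseteq> completion X P Q K} = {E \<in> ?F. E \<in> K}"
      by (intro Collect_cong conj_cong refl)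
    also have "\<dots> = K"
      using K by (simp add: Int_absorb1 flip: Int_def)
    finally show "{E \<in> ?F. Parallel ` E \<subseteq> completion X P Q K} = K" .
  qed
  show "\<forall>M\<in>{M \<in> dimer_configs G. present M = X}.
      completion X P Q {E \<in> ?F. Parallel ` E \<subseteq> M} = M"
  proof
    fix M assume "M \<in> {M \<in> dimer_configs G. present M = X}"
    then have M: "M \<in> dimer_configs G" "present M = X"
      by simp_all
    let ?K = "{E \<in> ?F. Parallel ` E \<subseteq> M}"
    have K: "?K \<in> Pow ?F" by blast
    have internal: "Parallel d \<in> completion X P Q ?K \<longleftrightarrow> Parallel d \<in> M"
      "Dual_parallel d \<in> completion X P Q ?K \<longleftrightarrow> Dual_parallel d \<in> M" if d: "d \<in> D" for d
    proof -
      have 1: "d \<in> \<Union>?K \<longleftrightarrow> e d \<in> ?F \<and> Parallel d \<in> M \<and> Parallel (f d) \<in> M"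
        unfolding in_Union_edges[OF FE[OF K]] using d by (auto simp: edge_of_def)
      have 2: "d \<in> \<Union>(?F - ?K) \<longleftrightarrow> e d \<in> ?F \<and> \<not> (Parallel d \<in> M \<and> Parallel (f d) \<in> M)"
        unfolding in_Union_free_edges using d by (auto simp: edge_of_def)
      note rules = interfaces_edge[OF X(1) d] disj'[of d] dimer_corners[OF M(1) d, unfolded M(2)]
      show "Parallel d \<in> completion X P Q ?K \<longleftrightarrow> Parallel d \<in> M"
        unfolding in_completion 1 edge_of_in_free_edges[OF d]
        using rules d unfolding exactly_one_def by argo
      show "Dual_parallel d \<in> completion X P Q ?K \<longleftrightarrow> Dual_parallel d \<in> M"
        unfolding in_completion 2 edge_of_in_free_edges[OF d]
        using rules d unfolding exactly_one_def by argo
    qed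
    have "q \<in> completion X P Q ?K \<longleftrightarrow> q \<in> M" for q
    proof (cases q)
      case (External d)
      then show ?thesis using M(2) by (simp add: in_completion present_def set_eq_iff)
    next
      case (Parallel d)
      have "d \<in> D" if "Parallel d \<in> M"
        using that M(1) by (auto simp: dimer_configs_def quad_edges_def)
      moreover have "d \<in> D" if "Parallel d \<in> completion X P Q ?K"
        using that unfolding in_completion in_Union_edges[OF FE[OF K]] by blast
      ultimately show ?thesis using internal(1) Parallel by blast
    next
      case (Dual_parallel d)
      have "d \<in> D" if "Dual_parallel d \<in> M"
        using that M(1) by (auto simp: dimer_configs_def quad_edges_def)
      moreover have "d \<in> D" if "Dual_parallel d \<in> completion X P Q ?K"
        using that unfolding in_completion in_Union_free_edges by blast
      ultimately show ?thesis using internal(2) Dual_parallel by blast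
    qed
    then show "completion X P Q ?K = M"
      by (rule set_eqI)
  qed
qed blast

lemma prod_darts_of_edges:
  fixes g :: "'d set \<Rightarrow> real"
  assumes "K \<subseteq> edges G"
  shows "(\<Prod>d\<in>\<Union>K. g (e d)) = (\<Prod>E\<in>K. g E ^ 2)"
proof -
  have inner: "(\<Prod>d\<in>E. g (e d)) = g E ^ 2" if E: "E \<in> K" for E
  proof -
    obtain d where d: "d \<in> D" "E = e d"
      using E assms unfolding edges_def by blast
    then have "E = {d, f d}" by (simp add: edge_of_def)
    then show ?thesis
      using d flip_neq[OF d(1)] by (simp add: power2_eq_square)
  qed
  have "(\<Prod>d\<in>\<Union>K. g (e d)) = (\<Prod>E\<in>K. \<Prod>d\<in>E. g (e d))"
  proof (subst prod.Union_disjoint)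
    show "\<forall>A\<in>K. finite A"
      using assms by (auto simp: edges_def edge_of_def)
    show "\<forall>A\<in>K. \<forall>B\<in>K. A \<noteq> B \<longrightarrow> A \<inter> B = {}"
    proof (intro ballI impI, rule ccontr)
      fix A B assume AB: "A \<in> K" "B \<in> K" "A \<noteq> B" "A \<inter> B \<noteq> {}"
      then obtain d where "d \<in> A" "d \<in> B" by blast
      then show False
        using edge_of_eqI[of A d] edge_of_eqI[of B d] AB assms by blast
    qed
  qed simp
  then show ?thesis using inner by simp
qed

text \<open>
  Whether it is the edge or its dual edge that separates present from absent sectors, the two
  opposite sectors \<open>d\<close> and \<open>f d\<close> are in different states. So each edge of \<open>P\<close> has one dart outside \<open>X\<close>.
\<close>

lemma prod_absent_darts:
  fixes g :: "'d set \<Rightarrow> real"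
  assumes "P \<subseteq> edges G" "\<And>d. d \<in> D \<Longrightarrow> e d \<in> P \<Longrightarrow> (d \<in> X) \<noteq> (f d \<in> X)"
  shows "(\<Prod>d\<in>{d \<in> D - X. e d \<in> P}. g (e d)) = (\<Prod>E\<in>P. g E)"
proof (rule prod.reindex_bij_betw)
  have "inj_on e {d \<in> D - X. e d \<in> P}"
    using assms(2) by (auto simp: inj_on_def edge_of_eq_iff)
  moreover have "P \<subseteq> e ` {d \<in> D - X. e d \<in> P}"
  proof
    fix E assume E: "E \<in> P"
    then obtain d where d: "d \<in> D" "E = e d"
      using assms(1) unfolding edges_def by blast
    then have "d \<notin> X \<or> f d \<notin> X"
      using assms(2) E by blast
    then show "E \<in> e ` {d \<in> D - X. e d \<in> P}"
      using d E by (auto intro: image_eqI[of _ _ d] image_eqI[of _ _ "f d"])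
  qed
  ultimately show "bij_betw e {d \<in> D - X. e d \<in> P} P"
    by (auto simp: bij_betw_def)
qed

end

abbreviation (input) primal_weight :: "('d set \<Rightarrow> real) \<Rightarrow> 'd set \<Rightarrow> real" where
  "primal_weight J E \<equiv> 2 * exp (- 2 * J E) / (1 + exp (- 4 * J E))"

abbreviation (input) dual_weight :: "('d set \<Rightarrow> real) \<Rightarrow> 'd set \<Rightarrow> real" where
  "dual_weight J E \<equiv> (1 - exp (- 4 * J E)) / (1 + exp (- 4 * J E))"

text \<open>
  With \<open>x = exp (- 2 * J E)\<close> this is the rational parametrisation of the unit circle.
\<close>

lemma weights_on_circle: "primal_weight J E ^ 2 + dual_weight J E ^ 2 = 1"
proof -
  have "exp (- 4 * J E) = exp (- 2 * J E) ^ 2"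
    by (simp flip: exp_of_nat_mult)
  moreover have "(2 * x / (1 + x ^ 2)) ^ 2 + ((1 - x ^ 2) / (1 + x ^ 2)) ^ 2 = 1" for x :: real
  proof -
    have "1 + x ^ 2 \<noteq> 0"
      using zero_le_power2[of x] by linarith
    moreover have "(2 * x) ^ 2 + (1 - x ^ 2) ^ 2 = (1 + x ^ 2) ^ 2"
      by algebra
    ultimately show ?thesis
      by (simp add: power_divide flip: add_divide_distrib)
  qed
  ultimately show ?thesis by simp
qed

context rotation_system
begin

text \<open>
  A covered free quadrangle contains two internal edges of the same kind, one for each dart of its
  edge, and so contributes a square.
\<close>

lemma completion_weight:
  assumes X: "interfaces X P Q" "X \<subseteq> D" and disj: "P \<inter> Q = {}" and K: "K \<subseteq> free_edges X P Q"
  shows "dimer_weight G J (completion X P Q K) =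
    (\<Prod>E\<in>P. primal_weight J E) * (\<Prod>E\<in>Q. dual_weight J E) *
    ((\<Prod>E\<in>K. primal_weight J E ^ 2) * (\<Prod>E\<in>free_edges X P Q - K. dual_weight J E ^ 2))"
proof -
  let ?a = "primal_weight J" and ?b = "dual_weight J" and ?F = "free_edges X P Q"
  have PQ: "P \<subseteq> edges G" "Q \<subseteq> edges G"
    using X(1) by (auto simp: interfaces_def)
  have sub: "K \<subseteq> edges G" "?F - K \<subseteq> edges G"
    using K free_edges_subset by blast+
  have fin: "finite X" "finite (\<Union>K)" "finite (\<Union>(?F - K))"
    using X(2) in_Union_edges[OF sub(1)] in_Union_edges[OF sub(2)]
    by (blast intro: finite_subset[OF _ finite_darts])+
  have P: "(\<Prod>d\<in>{d \<in> D - X. e d \<in> P}. ?a (e d)) = (\<Prod>E\<in>P. ?a E)"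
    by (rule prod_absent_darts[OF PQ(1)]) (use interfaces_edge[OF X(1)] disj in blast)
  have Q: "(\<Prod>d\<in>{d \<in> D - X. e d \<in> Q}. ?b (e d)) = (\<Prod>E\<in>Q. ?b E)"
    by (rule prod_absent_darts[OF PQ(2)]) (use interfaces_edge[OF X(1)] disj in blast)
  have "dimer_weight G J (completion X P Q K) =
      (\<Prod>q\<in>External ` X. quad_weight G J q) *
      (\<Prod>q\<in>Parallel ` (\<Union>K \<union> {d \<in> D - X. e d \<in> P}). quad_weight G J q) *
      (\<Prod>q\<in>Dual_parallel ` (\<Union>(?F - K) \<union> {d \<in> D - X. e d \<in> Q}). quad_weight G J q)"
    unfolding dimer_weight_def completion_def
  proof -
    let ?A = "External ` X" and ?B = "Parallel ` (\<Union>K \<union> {d \<in> D - X. e d \<in> P})"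
      and ?C = "Dual_parallel ` (\<Union>(?F - K) \<union> {d \<in> D - X. e d \<in> Q})"
    have fin': "finite ?A" "finite ?B" "finite ?C"
      using fin finite_darts by simp_all
    have "?A \<inter> ?B = {}" "(?A \<union> ?B) \<inter> ?C = {}"
      by blast+
    then show "prod (quad_weight G J) (?A \<union> ?B \<union> ?C) =
        prod (quad_weight G J) ?A * prod (quad_weight G J) ?B * prod (quad_weight G J) ?C"
      using fin' by (simp only: prod.union_disjoint finite_UnI)
  qed
  also have "(\<Prod>q\<in>External ` X. quad_weight G J q) = 1"
    by (subst prod.reindex) (auto simp: inj_on_def)
  also have "(\<Prod>q\<in>Parallel ` (\<Union>K \<union> {d \<in> D - X. e d \<in> P}). quad_weight G J q) =
      (\<Prod>d\<in>\<Union>K \<union> {d \<in> D - X. e d \<in> P}. ?a (e d))"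
    by (subst prod.reindex) (auto simp: inj_on_def)
  also have "\<dots> = (\<Prod>d\<in>\<Union>K. ?a (e d)) * (\<Prod>d\<in>{d \<in> D - X. e d \<in> P}. ?a (e d))"
    by (rule prod.union_disjoint)
      (use fin finite_darts in_Union_edges[OF sub(1)] K in \<open>auto simp: free_edges_def\<close>)
  also have "\<dots> = (\<Prod>E\<in>K. ?a E ^ 2) * (\<Prod>E\<in>P. ?a E)"
    unfolding P prod_darts_of_edges[OF sub(1), of ?a] ..
  also have "(\<Prod>q\<in>Dual_parallel ` (\<Union>(?F - K) \<union> {d \<in> D - X. e d \<in> Q}). quad_weight G J q) =
      (\<Prod>d\<in>\<Union>(?F - K) \<union> {d \<in> D - X. e d \<in> Q}. ?b (e d))"
    by (subst prod.reindex) (auto simp: inj_on_def)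
  also have "\<dots> = (\<Prod>d\<in>\<Union>(?F - K). ?b (e d)) * (\<Prod>d\<in>{d \<in> D - X. e d \<in> Q}. ?b (e d))"
    by (rule prod.union_disjoint)
      (use fin finite_darts in_Union_edges[OF sub(2)] in \<open>auto simp: free_edges_def\<close>)
  also have "\<dots> = (\<Prod>E\<in>?F - K. ?b E ^ 2) * (\<Prod>E\<in>Q. ?b E)"
    unfolding Q prod_darts_of_edges[OF sub(2), of ?b] ..
  finally show ?thesis
    by (simp only: mult_ac mult_1_left)
qed

text \<open>
  The sum over the coverings of the free quadrangles factorises, and each free quadrangle
  contributes the factor \<open>1\<close> because the squares of its two weights add up to \<open>1\<close>.
\<close>

lemma weight_of_present_set:
  assumes X: "interfaces X P Q" "X \<subseteq> D" and disj: "P \<inter> Q = {}"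
  shows "(\<Sum>M\<in>{M \<in> dimer_configs G. present M = X}. dimer_weight G J M) =
    (\<Prod>E\<in>P. primal_weight J E) * (\<Prod>E\<in>Q. dual_weight J E)"
proof -
  let ?a = "primal_weight J" and ?b = "dual_weight J" and ?F = "free_edges X P Q"
  have fin: "finite ?F"
    by (rule finite_subset[OF free_edges_subset finite_edges])
  have "(\<Sum>M\<in>{M \<in> dimer_configs G. present M = X}. dimer_weight G J M) =
      (\<Sum>K\<in>Pow ?F. dimer_weight G J (completion X P Q K))"
    by (rule sum.reindex_bij_betw[OF completions[OF assms], symmetric])
  also have "\<dots> = (\<Sum>K\<in>Pow ?F. (\<Prod>E\<in>P. ?a E) * (\<Prod>E\<in>Q. ?b E) *
      ((\<Prod>E\<in>K. ?a E ^ 2) * (\<Prod>E\<in>?F - K. ?b E ^ 2)))"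
    by (rule sum.cong[OF refl]) (simp only: completion_weight[OF assms] Pow_iff)
  also have "\<dots> = (\<Prod>E\<in>P. ?a E) * (\<Prod>E\<in>Q. ?b E) * (\<Prod>E\<in>?F. ?a E ^ 2 + ?b E ^ 2)"
    unfolding sum_distrib_left[symmetric] prod_add[OF fin] ..
  also have "\<dots> = (\<Prod>E\<in>P. ?a E) * (\<Prod>E\<in>Q. ?b E)"
    unfolding weights_on_circle by simp
  finally show ?thesis .
qed

end

section \<open>Connected surfaces\<close>

locale connected_rotation_system = rotation_system G for G :: "'d comb_map" +
  assumes darts_nonempty: "darts G \<noteq> {}"
    and connected: "\<lbrakk>d \<in> darts G; d' \<in> darts G\<rbrakk> \<Longrightarrow>
      (d, d') \<in> ({(x, rot G x) |x. x \<in> darts G} \<union> {(x, flip G x) |x. x \<in> darts G})\<^sup>*"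
begin

text \<open>
  The places where two solutions agree are closed under \<open>r\<close> and \<open>\<phi>\<close>, hence under \<open>f = r \<circ> \<phi>\<close>.
\<close>

lemma interfaces_two_solutions:
  assumes X: "interfaces X P Q" "X \<subseteq> D" and Y: "interfaces Y P Q" "Y \<subseteq> D"
  shows "Y = X \<or> Y = D - X"
proof -
  let ?A = "\<lambda>d. (d \<in> X) = (d \<in> Y)"
  have inv: "?A (r' d) = ?A d" and face: "?A (\<phi> d) = ?A d" if "d \<in> D" for d
    using interfacesD[OF X(1) that] interfacesD[OF Y(1) that] by blast+
  have rot: "?A (r d) = ?A d" if "d \<in> D" for d
    using inv[of "r d"] that by simp
  have flip: "?A (f d) = ?A d" if "d \<in> D" for d
    using rot[of "\<phi> d"] face[of d] that by (simp add: face_next_apply)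
  obtain d\<^sub>0 where d0: "d\<^sub>0 \<in> D" using darts_nonempty by blast
  have "?A d = ?A d\<^sub>0" if "d \<in> D" for d
    using connected[OF d0 that]
  proof induction
    case (step y z)
    then show ?case using rot flip by auto
  qed simp
  then show ?thesis
    using X(2) Y(2) by blast
qed

text \<open>
  The two solutions \<open>X\<close> and \<open>D - X\<close> are distinct and have the same weight, which depends only on
  \<open>P\<close> and \<open>Q\<close>.
\<close>

lemma weight_of_Poly_fibre:
  assumes PQ: "(P, Q) \<in> disjoint_zero_pairs G"
  shows "(\<Sum>M\<in>{M \<in> dimer_configs G. Poly G M = (P, Q)}. dimer_weight G J M) =
    2 * (\<Prod>E\<in>P. primal_weight J E) * (\<Prod>E\<in>Q. dual_weight J E)"
proof -
  have disj: "P \<inter> Q = {}"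
    using PQ by (simp add: disjoint_zero_pairs_def)
  obtain X where X: "interfaces X P Q" "X \<subseteq> D"
    using PQ interfaces_exist[of P Q] by (auto simp: disjoint_zero_pairs_def)
  have X': "interfaces (D - X) P Q" "D - X \<subseteq> D"
    using interfaces_Compl[OF X(1)] by auto
  let ?S = "\<lambda>X. {M \<in> dimer_configs G. present M = X}"
  have "{M \<in> dimer_configs G. Poly G M = (P, Q)} = ?S X \<union> ?S (D - X)"
  proof -
    have "Poly G M = (P, Q) \<longleftrightarrow> present M = X \<or> present M = D - X" if M: "M \<in> dimer_configs G" for M
      unfolding Poly_eq_iff_interfaces[OF M]
      using interfaces_two_solutions[OF X _ present_subset[OF M]] X(1) X'(1) by metis
    then show ?thesis by auto
  qed
  moreover have "?S X \<inter> ?S (D - X) = {}"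
  proof -
    have "X \<noteq> D - X"
      using darts_nonempty X(2) by auto
    then show ?thesis by auto
  qed
  ultimately have "(\<Sum>M\<in>{M \<in> dimer_configs G. Poly G M = (P, Q)}. dimer_weight G J M) =
      (\<Sum>M\<in>?S X. dimer_weight G J M) + (\<Sum>M\<in>?S (D - X). dimer_weight G J M)"
    using finite_dimer_configs by (simp add: sum.union_disjoint)
  then show ?thesis
    unfolding weight_of_present_set[OF X disj] weight_of_present_set[OF X' disj] by simp
qed

text \<open>
  A zero pair is attained because the total weight of its fibre is positive.
\<close>

lemma Poly_image:
  fixes J :: "'d set \<Rightarrow> real"
  assumes J: "\<And>E. E \<in> edges G \<Longrightarrow> 0 < J E"
  shows "Poly G ` zero_dimer_configs G = disjoint_zero_pairs G"
proof
  show "Poly G ` zero_dimer_configs G \<subseteq> disjoint_zero_pairs G"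
    using dimer_interfaces(2) interfaces_zero_dual[OF dimer_interfaces(1)]
    by (auto simp: zero_dimer_configs_def Poly_def disjoint_zero_pairs_def)
  show "disjoint_zero_pairs G \<subseteq> Poly G ` zero_dimer_configs G"
  proof safe
    fix P Q assume PQ: "(P, Q) \<in> disjoint_zero_pairs G"
    then have Q: "Q \<subseteq> edges G" and P: "P \<in> zero_polygon_configs G"
      by (auto simp: disjoint_zero_pairs_def zero_polygon_configs_def polygon_configs_def)
    have "0 < (\<Prod>E\<in>P. primal_weight J E)"
      by (intro prod_pos) (auto intro!: divide_pos_pos add_pos_pos)
    moreover have "0 < (\<Prod>E\<in>Q. dual_weight J E)"
      by (intro prod_pos) (use Q J in \<open>auto intro!: divide_pos_pos add_pos_pos\<close>)
    ultimately have "(\<Sum>M\<in>{M \<in> dimer_configs G. Poly G M = (P, Q)}. dimer_weight G J M) \<noteq> 0"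
      unfolding weight_of_Poly_fibre[OF PQ] by (simp add: less_imp_neq[symmetric])
    then obtain M where "M \<in> dimer_configs G" "Poly G M = (P, Q)"
      by (metis (mono_tags, lifting) mem_Collect_eq sum.neutral)
    then show "(P, Q) \<in> Poly G ` zero_dimer_configs G"
      using P by (intro image_eqI[of _ _ M]) (auto simp: zero_dimer_configs_def Poly_def)
  qed
qed

lemma zero_fibre:
  assumes "(P, Q) \<in> disjoint_zero_pairs G"
  shows "{M \<in> zero_dimer_configs G. Poly G M = (P, Q)} = {M \<in> dimer_configs G. Poly G M = (P, Q)}"
  using assms by (auto simp: zero_dimer_configs_def Poly_def disjoint_zero_pairs_def)

lemma Z0_quadri_eq:
  assumes "\<And>E. E \<in> edges G \<Longrightarrow> 0 < J E"
  shows "Z0_quadri G J = 2 * (\<Sum>(P, Q)\<in>disjoint_zero_pairs G.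
    (\<Prod>E\<in>P. primal_weight J E) * (\<Prod>E\<in>Q. dual_weight J E))"
proof -
  have image: "Poly G ` zero_dimer_configs G = disjoint_zero_pairs G"
    by (rule Poly_image) (rule assms)
  have fin: "finite (zero_dimer_configs G)"
    using finite_dimer_configs by (simp add: zero_dimer_configs_def)
  then have fin_pairs: "finite (disjoint_zero_pairs G)"
    unfolding image[symmetric] by (rule finite_imageI)
  have "Z0_quadri G J = (\<Sum>p\<in>disjoint_zero_pairs G.
      \<Sum>M\<in>{M \<in> zero_dimer_configs G. Poly G M = p}. dimer_weight G J M)"
    unfolding Z0_quadri_def by (rule sum.group[OF fin fin_pairs, symmetric]) (simp add: image)
  also have "\<dots> = (\<Sum>(P, Q)\<in>disjoint_zero_pairs G.
      2 * ((\<Prod>E\<in>P. primal_weight J E) * (\<Prod>E\<in>Q. dual_weight J E)))"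
  proof (rule sum.cong[OF refl])
    fix p assume p: "p \<in> disjoint_zero_pairs G"
    obtain P Q where PQ: "p = (P, Q)" by (cases p)
    show "(\<Sum>M\<in>{M \<in> zero_dimer_configs G. Poly G M = p}. dimer_weight G J M) =
      (case p of (P, Q) \<Rightarrow> 2 * ((\<Prod>E\<in>P. primal_weight J E) * (\<Prod>E\<in>Q. dual_weight J E)))"
      using p unfolding PQ by (simp only: zero_fibre weight_of_Poly_fibre prod.case mult.assoc)
  qed
  finally show ?thesis
    by (simp add: sum_distrib_left case_prod_unfold)
qed

end

theorem proposition2:
  fixes G :: "'d comb_map" and J :: "'d set \<Rightarrow> real"
  assumes "cellularly_embedded G"
    and "\<forall>e\<in>edges (dual G). 0 < J e"
  shows "Z0_quadri G J =
           2 * (\<Sum>(P, Q)\<in>disjoint_zero_pairs G.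
                  (\<Prod>e\<in>P. 2 * exp (- 2 * J e) / (1 + exp (- 4 * J e))) *
                  (\<Prod>e\<in>Q. (1 - exp (- 4 * J e)) / (1 + exp (- 4 * J e))))
       \<and> Poly G ` zero_dimer_configs G = disjoint_zero_pairs G
       \<and> (\<forall>(P, Q)\<in>disjoint_zero_pairs G.
            (\<Sum>M\<in>{M \<in> dimer_configs G. Poly G M = (P, Q)}. dimer_weight G J M) =
            2 * (\<Prod>e\<in>P. 2 * exp (- 2 * J e) / (1 + exp (- 4 * J e))) *
                (\<Prod>e\<in>Q. (1 - exp (- 4 * J e)) / (1 + exp (- 4 * J e))))"
proof -
  interpret connected_rotation_system G
    using assms(1) by unfold_locales (auto simp: cellularly_embedded_def)
  have J: "\<And>E. E \<in> edges G \<Longrightarrow> 0 < J E"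
    using assms(2) by simp
  show ?thesis
    by (intro conjI Z0_quadri_eq[OF J] Poly_image[OF J] ballI case_prodI2)
      (simp_all add: weight_of_Poly_fibre)
qed

end
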